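(* For every natural number $p\ge 8$, the group $G=BS(1,p)=\langle a,t\mid tat^{-1}=a^{p}\rangle$ with generating set $A=\{a^{\pm1},t^{\pm1}\}$ does not admit a 1-combing (of the Cayley complex of this presentation) with radial tameness function of the form $\rho(q)=q+C$ for any constant $C$.
   Context: Let $X$ be the Cayley 2-complex of the presentation $\langle a,t\mid tat^{-1}=a^p\rangle$, with $X^0=G$, $X^1$ the Cayley graph over $A$, and $\epsilon$ the identity vertex. Levels: for $g\in X^0$, $\mathrm{lev}(g)$ is the word length of $g$ over $A$; for $x$ in the interior of an edge with endpoints $g,h$, $\mathrm{lev}(x)=\frac{\mathrm{lev}(g)+\mathrm{lev}(h)}{2}+\frac14$; for $x$ in the interior of a 2-cell with boundary vertices $g_1,\dots,g_n$, $\mathrm{lev}(x)=\frac{1}{n}\sum\mathrm{lev}(g_i)+\frac14+\frac1c$ with $c=4(p+3)+1$ (four times the relator length, plus one). A 1-combing is a continuous $\Psi:X^1\times[0,1]\to X$ with $\Psi(x,0)=\epsilon$, $\Psi(x,1)=x$ for all $x\in X^1$, and $\Psi(X^0\times[0,1])\subseteq X^1$. A function $\rho:\mathbb{Q}\to\mathbb{R}_+$ is a radial tameness function for $\Psi$ if for all $x\in X^1$, $0\le s<t\le1$, $q\in\mathbb{Q}$, $\mathrm{lev}(\Psi(x,s))>\rho(q)$ implies $\mathrm{lev}(\Psi(x,t))>q$. *)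

theory Defs
  imports "HOL-Analysis.Analysis"
begin

text \<open>Positive generators a and t; a letter is a generator together with a sign
  (True = the generator itself, False = its inverse).  Words are lists of letters.\<close>

datatype gen = GA | GT

type_synonym letter = "gen \<times> bool"

definition inv_letter :: "letter \<Rightarrow> letter" where
  "inv_letter l = (fst l, \<not> snd l)"

inductive bs_eq :: "nat \<Rightarrow> letter list \<Rightarrow> letter list \<Rightarrow> bool" for p where
  bs_refl: "bs_eq p w w"
| bs_sym: "bs_eq p u v \<Longrightarrow> bs_eq p v u"
| bs_trans: "bs_eq p u v \<Longrightarrow> bs_eq p v w \<Longrightarrow> bs_eq p u w"
| bs_cancel: "bs_eq p (u @ [x, inv_letter x] @ v) (u @ v)"
| bs_rel: "bs_eq p (u @ [(GT, True), (GA, True), (GT, False)] @ v) (u @ replicate p (GA, True) @ v)"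

type_synonym bsg = "letter list set"

definition bs_elem :: "nat \<Rightarrow> letter list \<Rightarrow> bsg" where
  "bs_elem p w = {v. bs_eq p w v}"

definition bs_group :: "nat \<Rightarrow> bsg set" where
  "bs_group p = range (bs_elem p)"

definition bs_one :: "nat \<Rightarrow> bsg" where
  "bs_one p = bs_elem p []"

definition bs_rmul :: "nat \<Rightarrow> bsg \<Rightarrow> letter list \<Rightarrow> bsg" where
  "bs_rmul p g w = {v. \<exists>u\<in>g. bs_eq p (u @ w) v}"

definition bs_wlen :: "nat \<Rightarrow> bsg \<Rightarrow> nat" where
  "bs_wlen p g = (LEAST n. \<exists>w. bs_elem p w = g \<and> length w = n)"

definition rel_word :: "nat \<Rightarrow> letter list" where
  "rel_word p = [(GT, True), (GA, True), (GT, False)] @ replicate p (GA, False)"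

definition bvert :: "nat \<Rightarrow> bsg \<Rightarrow> nat \<Rightarrow> bsg" where
  "bvert p g j = bs_rmul p g (take j (rel_word p))"

text \<open>Points: vertices V g; interior points E g s u (0<u<1) of the edge from g to g s
  (s a positive generator); interior points F g z (|z|<1) of the 2-cell attached along the
  relator loop read from g.\<close>

datatype pt = V bsg | E bsg gen real | F bsg complex

definition cx_points :: "nat \<Rightarrow> pt set" where
  "cx_points p = {V g | g. g \<in> bs_group p}
     \<union> {E g s u | g s u. g \<in> bs_group p \<and> 0 < u \<and> u < 1}
     \<union> {F g z | g z. g \<in> bs_group p \<and> norm z < 1}"

definition cx_X1 :: "nat \<Rightarrow> pt set" where
  "cx_X1 p = {V g | g. g \<in> bs_group p} \<union> {E g s u | g s u. g \<in> bs_group p \<and> 0 < u \<and> u < 1}"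

definition edge_map :: "nat \<Rightarrow> bsg \<Rightarrow> gen \<Rightarrow> real \<Rightarrow> pt" where
  "edge_map p g s u = (if u \<le> 0 then V g else if 1 \<le> u then V (bs_rmul p g [(s, True)]) else E g s u)"

text \<open>Characteristic map of a closed 2-cell (the closed unit disc): the boundary circle is
  divided into p+3 equal arcs, the j-th of which runs along the edge labelled by the j-th
  letter of the relator (backwards for inverse letters).\<close>
definition face_map :: "nat \<Rightarrow> bsg \<Rightarrow> complex \<Rightarrow> pt" where
  "face_map p g z =
    (if norm z < 1 then F g z
     else (let n = p + 3; \<phi> = real n * frac (Arg z / (2 * pi)); j = nat \<lfloor>\<phi>\<rfloor>; u = frac \<phi>;
               l = rel_word p ! j
           in if snd l then edge_map p (bvert p g j) (fst l) u
              else edge_map p (bvert p g (j + 1)) (fst l) (1 - u)))"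

definition cx_open :: "nat \<Rightarrow> pt set \<Rightarrow> bool" where
  "cx_open p U \<longleftrightarrow> U \<subseteq> cx_points p
     \<and> (\<forall>g\<in>bs_group p. \<forall>s. openin (top_of_set {0..1::real}) {u \<in> {0..1}. edge_map p g s u \<in> U})
     \<and> (\<forall>g\<in>bs_group p. openin (top_of_set (cball (0::complex) 1)) {z \<in> cball 0 1. face_map p g z \<in> U})"

lemma istopology_cx_open: "istopology (cx_open p)"
proof -
  have pre_int: "{x \<in> S. f x \<in> U \<inter> W} = {x \<in> S. f x \<in> U} \<inter> {x \<in> S. f x \<in> W}" for S f U W
    by auto
  have pre_Un: "{x \<in> S. f x \<in> \<Union>K} = \<Union>((\<lambda>U. {x \<in> S. f x \<in> U}) ` K)" for S f K
    by auto
  show ?thesis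
    unfolding istopology_def cx_open_def
    by (auto simp only: pre_int pre_Un intro!: openin_Int openin_Union)
qed

definition cx_top :: "nat \<Rightarrow> pt topology" where
  "cx_top p = topology (cx_open p)"

definition lev :: "nat \<Rightarrow> pt \<Rightarrow> real" where
  "lev p x = (case x of
      V g \<Rightarrow> real (bs_wlen p g)
    | E g s u \<Rightarrow> (real (bs_wlen p g) + real (bs_wlen p (bs_rmul p g [(s, True)]))) / 2 + 1/4
    | F g z \<Rightarrow> (\<Sum>j<p+3. real (bs_wlen p (bvert p g j))) / real (p + 3) + 1/4
                 + 1 / real (4 * (p + 3) + 1))"

definition is_1_combing :: "nat \<Rightarrow> (pt \<times> real \<Rightarrow> pt) \<Rightarrow> bool" where
  "is_1_combing p \<Psi> \<longleftrightarrow>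
     continuous_map (prod_topology (subtopology (cx_top p) (cx_X1 p)) (top_of_set {0..1})) (cx_top p) \<Psi>
     \<and> (\<forall>x\<in>cx_X1 p. \<Psi> (x, 0) = V (bs_one p) \<and> \<Psi> (x, 1) = x)
     \<and> (\<forall>g\<in>bs_group p. \<forall>s\<in>{0..1}. \<Psi> (V g, s) \<in> cx_X1 p)"

definition radial_tameness_function :: "nat \<Rightarrow> (pt \<times> real \<Rightarrow> pt) \<Rightarrow> (real \<Rightarrow> real) \<Rightarrow> bool" where
  "radial_tameness_function p \<Psi> \<rho> \<longleftrightarrow>
     (\<forall>x\<in>cx_X1 p. \<forall>s t q. 0 \<le> s \<longrightarrow> s < t \<longrightarrow> t \<le> 1 \<longrightarrow> q \<in> \<rat> \<longrightarrow>
        lev p (\<Psi> (x, s)) > \<rho> q \<longrightarrow> lev p (\<Psi> (x, t)) > q)"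

end

theory Submission
  imports Defs "HOL-Complex_Analysis.Complex_Analysis"
begin

text \<open>
  The universal cover of the presentation complex is (Bass-Serre tree) \<open>\<times> \<real>\<close>. The equal words
  \<open>t^h a t^-h a\<close> and \<open>a t^h a t^-h\<close> form a loop of vertices of level at most \<open>2h + 2\<close> which bounds
  two sheets glued along the integers \<open>1, \<dots>, p^h\<close> of the base line; any filling must contain all of
  these vertices. One of them is \<open>c = 3 + 3p + \<dots> + 3p^(h-1)\<close>, and as \<open>3 < p / 2\<close> every word for
  \<open>a^c\<close> contains at least \<open>3h\<close> letters \<open>a^\<plusminus>1\<close>. A combing with radial tameness function \<open>q + C\<close>
  keeps the filling of the loop within level \<open>2h + 3 + max C 0\<close>, which is less than \<open>3h\<close> for large \<open>h\<close>.

  That the filling meets \<open>a^c\<close> is seen by mapping the complex to the plane, continuously and so that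
  only elements with the coordinates of \<open>a^c\<close> go to \<open>0\<close>: a vertex is sent to
  \<open>sgn (b - c) + \<i> * side\<close>, edges are mapped linearly, and faces are coned off from \<open>\<plusminus> \<i>\<close>. The loop
  becomes the boundary of the square \<open>[-1, 1] \<times> [-1, 1]\<close>, of winding number \<open>\<plusminus> 1\<close>, whereas a filling
  that avoids \<open>0\<close> makes the winding numbers along the edges the increments of a function of the
  vertices, so that they add up to \<open>0\<close> around the loop.
\<close>

subsection \<open>Affine coordinates and relations\<close>

text \<open>The coordinates \<open>(k, b)\<close> record the affine map \<open>x \<mapsto> p ^ k * x + b\<close>.\<close>
fun step :: "nat \<Rightarrow> int \<times> real \<Rightarrow> letter \<Rightarrow> int \<times> real" where
  "step p (k, b) (GA, s) = (k, b + (if s then 1 else -1) * real p powi k)"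
| "step p (k, b) (GT, s) = (k + (if s then 1 else -1), b)"

definition act :: "nat \<Rightarrow> int \<times> real \<Rightarrow> letter list \<Rightarrow> int \<times> real" where
  "act p x w = foldl (step p) x w"

lemma act_Nil [simp]: "act p x [] = x"
  and act_Cons [simp]: "act p x (l # w) = act p (step p x l) w"
  and act_append [simp]: "act p x (u @ v) = act p (act p x u) v"
  by (simp_all add: act_def)

lemma act_replicate_GA:
  "act p (k, b) (replicate n (GA, s)) = (k, b + (if s then 1 else -1) * real n * real p powi k)"
  by (induction n arbitrary: b) (auto simp: algebra_simps)

lemma act_replicate_GT:
  "act p (k, b) (replicate n (GT, s)) = (k + (if s then 1 else -1) * int n, b)"
  by (induction n arbitrary: k) (auto simp: algebra_simps)

lemma step_cancel: "step p (step p x l) (inv_letter l) = x"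
  by (cases x; cases l; cases "fst l") (auto simp: inv_letter_def)

lemma powi_Suc: "p > 0 \<Longrightarrow> real p powi (k + 1) = real p * real p powi k"
  by (simp add: power_int_add)

text \<open>Right multiplication by either side of a relation has the same effect on coordinates.
  The start \<open>x\<close> stays arbitrary because a relation is applied after a prefix.\<close>

lemma bs_eq_act:
  assumes "bs_eq p u v" "p > 0"
  shows "act p x u = act p x v"
  using assms
proof (induction arbitrary: x)
  case (bs_cancel u l v)
  then show ?case by (simp add: step_cancel)
next
  case (bs_rel u v)
  obtain k b where "act p x u = (k, b)" by (meson surj_pair)
  with bs_rel show ?case by (simp add: act_replicate_GA powi_Suc)
qed auto

lemma bs_eq_append:
  assumes "bs_eq p u v"
  shows "bs_eq p (w @ u @ z) (w @ v @ z)"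
  using assms
proof induction
  case (bs_cancel u x v)
  then show ?case using bs_eq.bs_cancel[of p "w @ u" x "v @ z"] by simp
next
  case (bs_rel u v)
  then show ?case using bs_eq.bs_rel[of p "w @ u" "v @ z"] by simp
qed (auto intro: bs_eq.intros)

section \<open>Group elements, their affine coordinates and word length\<close>

lemma bs_elem_eq_iff: "bs_elem p u = bs_elem p v \<longleftrightarrow> bs_eq p u v"
  unfolding bs_elem_def by (auto intro: bs_eq.intros)

lemma bs_rmul_elem [simp]: "bs_rmul p (bs_elem p u) w = bs_elem p (u @ w)"
proof -
  have "bs_eq p (u @ w) v" if "bs_eq p u u'" "bs_eq p (u' @ w) v" for u' v
    using that bs_eq_append[OF that(1), of "[]" w] by (auto intro: bs_eq.intros)
  then show ?thesis
    unfolding bs_rmul_def bs_elem_def by (auto intro: bs_eq.intros)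
qed

lemma bs_elem_in_group [simp]: "bs_elem p w \<in> bs_group p"
  by (simp add: bs_group_def)

lemma bs_groupE: assumes "g \<in> bs_group p" obtains w where "g = bs_elem p w"
  using assms by (auto simp: bs_group_def)

lemma bs_rmul_in_group: "g \<in> bs_group p \<Longrightarrow> bs_rmul p g w \<in> bs_group p"
  by (auto simp: bs_group_def)

lemma bvert_in_group: "g \<in> bs_group p \<Longrightarrow> bvert p g j \<in> bs_group p"
  by (simp add: bvert_def bs_rmul_in_group)

definition coords :: "nat \<Rightarrow> bsg \<Rightarrow> int \<times> real" where
  "coords p g = act p (0, 0) (SOME w. w \<in> g)"

lemma coords_bs_elem [simp]:
  assumes "p > 0" shows "coords p (bs_elem p w) = act p (0, 0) w"
proof -
  have "w \<in> bs_elem p w" by (simp add: bs_elem_def bs_refl)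
  then have "(SOME v. v \<in> bs_elem p w) \<in> bs_elem p w" by (rule someI)
  then have "bs_eq p w (SOME v. v \<in> bs_elem p w)" by (simp add: bs_elem_def)
  from bs_eq_act[OF this assms] show ?thesis by (simp add: coords_def)
qed

lemma coords_rmul:
  "p > 0 \<Longrightarrow> g \<in> bs_group p \<Longrightarrow> coords p (bs_rmul p g w) = act p (coords p g) w"
  by (auto elim!: bs_groupE)

lemma bs_wlen_le: "bs_wlen p (bs_elem p w) \<le> length w"
  unfolding bs_wlen_def by (rule Least_le) auto

lemma bs_wlen_attained:
  assumes "g \<in> bs_group p"
  obtains w where "bs_elem p w = g" "length w = bs_wlen p g"
proof -
  have "\<exists>n w. bs_elem p w = g \<and> length w = n" using assms by (auto elim: bs_groupE)
  then have "\<exists>w. bs_elem p w = g \<and> length w = bs_wlen p g"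
    unfolding bs_wlen_def by (rule LeastI_ex)
  then show ?thesis using that by blast
qed

section \<open>Two words for \<open>a^(p^h + 1)\<close>\<close>

lemma bs_eq_conj_power:
  "bs_eq p ([(GT, True)] @ replicate m (GA, True) @ [(GT, False)]) (replicate (p * m) (GA, True))"
proof (induction m)
  case 0
  show ?case using bs_cancel[of p "[]" "(GT, True)" "[]"] by (simp add: inv_letter_def)
next
  case (Suc m)
  let ?a = "(GA, True)" and ?t = "(GT, True)" and ?T = "(GT, False)"
  \<comment> \<open>Inserting \<open>t^-1 t\<close> splits \<open>t a^(m+1) t^-1\<close> into
    \<open>t a t^-1\<close> and \<open>t a^m t^-1\<close>.\<close>
  have "bs_eq p ([?t, ?a] @ [?T, ?t] @ (replicate m ?a @ [?T])) ([?t, ?a] @ (replicate m ?a @ [?T]))"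
    using bs_cancel[of p "[?t, ?a]" ?T "replicate m ?a @ [?T]"] by (simp add: inv_letter_def)
  moreover have "bs_eq p ([?t, ?a, ?T] @ ([?t] @ replicate m ?a @ [?T]) @ [])
      ([?t, ?a, ?T] @ replicate (p * m) ?a @ [])"
    using Suc.IH by (rule bs_eq_append)
  moreover have "bs_eq p ([] @ [?t, ?a, ?T] @ replicate (p * m) ?a)
      ([] @ replicate p ?a @ replicate (p * m) ?a)"
    by (rule bs_rel)
  ultimately have "bs_eq p ([?t, ?a] @ (replicate m ?a @ [?T]))
      (replicate p ?a @ replicate (p * m) ?a)"
    by (auto intro: bs_eq.intros)
  then show ?case by (simp add: replicate_add)
qed

lemma bs_eq_conj_iterate:
  "bs_eq p (replicate h (GT, True) @ replicate m (GA, True) @ replicate h (GT, False))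
     (replicate (p ^ h * m) (GA, True))"
proof (induction h arbitrary: m)
  case 0
  show ?case by (simp add: bs_refl)
next
  case (Suc h)
  have "bs_eq p (replicate h (GT, True) @ ([(GT, True)] @ replicate m (GA, True) @ [(GT, False)]) @ replicate h (GT, False))
     (replicate h (GT, True) @ replicate (p * m) (GA, True) @ replicate h (GT, False))"
    by (rule bs_eq_append[OF bs_eq_conj_power])
  from bs_trans[OF this Suc.IH] show ?case
    by (simp add: replicate_app_Cons_same mult.assoc mult.left_commute)
qed

text \<open>Conjugating \<open>a\<close> by \<open>t^h\<close> gives the power
  \<open>a^(p^h)\<close>, which commutes with \<open>a\<close>.\<close>

lemma bs_eq_commute:
  "bs_eq p (replicate h (GT, True) @ [(GA, True)] @ replicate h (GT, False) @ [(GA, True)])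
     ([(GA, True)] @ replicate h (GT, True) @ [(GA, True)] @ replicate h (GT, False))"
proof -
  let ?x = "replicate h (GT, True) @ [(GA, True)] @ replicate h (GT, False)"
  have x: "bs_eq p ?x (replicate (p ^ h) (GA, True))"
    using bs_eq_conj_iterate[of p h 1] by simp
  have "bs_eq p (?x @ [(GA, True)]) (replicate (Suc (p ^ h)) (GA, True))"
    using bs_eq_append[OF x, of "[]" "[(GA, True)]"] by (simp add: replicate_append_same)
  moreover have "bs_eq p ([(GA, True)] @ ?x) (replicate (Suc (p ^ h)) (GA, True))"
    using bs_eq_append[OF x, of "[(GA, True)]" "[]"] by simp
  ultimately have "bs_eq p (?x @ [(GA, True)]) ([(GA, True)] @ ?x)"
    by (meson bs_sym bs_trans)
  then show ?thesis by simp
qed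

subsection \<open>Word length of the integers \<open>3 + 3 p + \<dots> + 3 p ^ (h - 1)\<close>\<close>

text \<open>The error \<open>e\<close> is a carry in base \<open>p\<close>, passed on to the next
  digit as \<open>f\<close>. As \<open>d 0\<close> is at most 3, a nonzero \<open>f\<close> forces
  \<open>|c 0| + |e|\<close> to be at least \<open>7 |f| - 3\<close>, hence at least
  \<open>|f| + 3\<close>: carrying never lowers the digit sum.\<close>

lemma digit_sum_bound:
  fixes c d :: "nat \<Rightarrow> int" and p :: int
  assumes "p \<ge> 7" "\<And>i. 0 \<le> d i \<and> d i \<le> 3"
    and "(\<Sum>i<M. c i * p ^ i) = (\<Sum>i<M. d i * p ^ i) + e"
  shows "(\<Sum>i<M. d i) \<le> (\<Sum>i<M. \<bar>c i\<bar>) + \<bar>e\<bar>"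
  using assms(2,3)
proof (induction M arbitrary: c d e)
  case 0
  then show ?case by simp
next
  case (Suc M)
  define A where "A = (\<Sum>i<M. c (Suc i) * p ^ i)"
  define B where "B = (\<Sum>i<M. d (Suc i) * p ^ i)"
  define f where "f = A - B"
  have "c 0 + p * A = d 0 + p * B + e"
    using Suc.prems(2) unfolding A_def B_def sum.lessThan_Suc_shift sum_distrib_left
    by (simp add: mult.left_commute)
  then have c0: "c 0 = d 0 + e - p * f" by (simp add: f_def algebra_simps)
  have IH: "(\<Sum>i<M. d (Suc i)) \<le> (\<Sum>i<M. \<bar>c (Suc i)\<bar>) + \<bar>f\<bar>"
    using Suc.prems(1) by (intro Suc.IH) (auto simp: f_def A_def B_def)
  have "d 0 + \<bar>f\<bar> \<le> \<bar>c 0\<bar> + \<bar>e\<bar>"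
  proof (cases "f = 0")
    case True
    then show ?thesis using c0 Suc.prems(1)[of 0] by auto
  next
    case False
    have "7 * \<bar>f\<bar> \<le> \<bar>p * f\<bar>" using assms(1) by (simp add: abs_mult mult_right_mono)
    then show ?thesis using c0 False Suc.prems(1)[of 0] by linarith
  qed
  with IH show ?case unfolding sum.lessThan_Suc_shift by simp
qed

text \<open>Multiplying by \<open>p ^ N\<close> clears the negative powers of \<open>p\<close>.\<close>
lemma act_expansion:
  assumes "p > 0" "length w \<le> N"
  shows "\<exists>c::nat \<Rightarrow> int. (\<forall>i>2*N. c i = 0) \<and> (\<Sum>i\<le>2*N. \<bar>c i\<bar>) \<le> int (length w)
     \<and> real p ^ N * snd (act p (0, 0) w) = (\<Sum>i\<le>2*N. of_int (c i) * real p ^ i)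
     \<and> \<bar>fst (act p (0, 0) w)\<bar> \<le> int (length w)"
  using assms(2)
proof (induction w rule: rev_induct)
  case Nil
  show ?case by (intro exI[of _ "\<lambda>_. 0"]) auto
next
  case (snoc l w)
  then obtain c where c: "\<forall>i>2*N. c i = (0::int)" "(\<Sum>i\<le>2*N. \<bar>c i\<bar>) \<le> int (length w)"
     "real p ^ N * snd (act p (0, 0) w) = (\<Sum>i\<le>2*N. of_int (c i) * real p ^ i)"
     "\<bar>fst (act p (0, 0) w)\<bar> \<le> int (length w)" by auto
  obtain k b where kb: "act p (0, 0) w = (k, b)" by (meson surj_pair)
  obtain s where l: "l = (GA, s) \<or> l = (GT, s)" by (metis gen.exhaust surj_pair)
  show ?case
  proof (cases "fst l")
    case GT
    with l have l: "l = (GT, s)" by auto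
    show ?thesis using c kb by (intro exI[of _ c]) (auto simp: l)
  next
    case GA
    with l have l: "l = (GA, s)" by auto
    define \<delta> :: int where "\<delta> = (if s then 1 else -1)"
    \<comment> \<open>The exponent \<open>k + N\<close> lies between \<open>0\<close> and
      \<open>2 * N\<close>, since \<open>|k|\<close> is at most the length of \<open>w\<close>; so
      \<open>nat\<close> truncates nothing.\<close>
    define j where "j = nat (k + int N)"
    have k: "\<bar>k\<bar> \<le> int (length w)" using c(4) kb by simp
    have j: "int j = k + int N" "j \<le> 2 * N" using k snoc.prems by (auto simp: j_def)
    have pk: "real p ^ N * real p powi k = real p ^ j"
    proof -
      have "real p ^ N * real p powi k = real p powi (int N + k)"
        using assms(1) by (subst power_int_add) auto
      also have "\<dots> = real p ^ j" using j by (metis add.commute power_int_of_nat)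
      finally show ?thesis .
    qed
    define d where "d = (\<lambda>i. c i + (if i = j then \<delta> else 0))"
    have "(\<Sum>i\<le>2*N. \<bar>d i\<bar>) \<le> (\<Sum>i\<le>2*N. \<bar>c i\<bar> + (if i = j then 1 else 0))"
      by (intro sum_mono) (auto simp: d_def \<delta>_def)
    also have "\<dots> \<le> int (length w) + 1" using c(2) j(2) by (simp add: sum.distrib)
    finally have 1: "(\<Sum>i\<le>2*N. \<bar>d i\<bar>) \<le> int (length w) + 1" .
    have "(\<Sum>i\<le>2*N. of_int (d i) * real p ^ i)
       = (\<Sum>i\<le>2*N. of_int (c i) * real p ^ i + (if i = j then of_int \<delta> * real p ^ i else 0))"
      by (intro sum.cong) (auto simp: d_def algebra_simps)
    also have "\<dots> = (\<Sum>i\<le>2*N. of_int (c i) * real p ^ i) + of_int \<delta> * real p ^ j"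
      using j(2) by (simp add: sum.distrib)
    also have "\<dots> = real p ^ N * (b + of_int \<delta> * real p powi k)"
      using c(3) kb pk by (simp add: algebra_simps)
    finally have 2: "real p ^ N * (b + of_int \<delta> * real p powi k) = (\<Sum>i\<le>2*N. of_int (d i) * real p ^ i)" ..
    show ?thesis using 1 2 c(1) j k kb
      by (intro exI[of _ d]) (auto simp: l d_def \<delta>_def)
  qed
qed

text \<open>The digit 3 beats the rate \<open>2 * h\<close> at which the level of the loop grows,
  while \<open>2 * 3 < 7\<close> keeps carries unprofitable.\<close>

definition threes :: "nat \<Rightarrow> nat \<Rightarrow> int" where
  "threes p h = (\<Sum>i<h. 3 * int p ^ i)"

text \<open>A word supplies an expansion with digit sum at most its length. Clearing negative powers
  by \<open>p^N\<close> moves the digits 3 to the positions \<open>N, ..., N + h - 1\<close>, and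
  \<open>digit_sum_bound\<close> compares the two expansions.\<close>

lemma threes_length_bound:
  assumes "p \<ge> 7" "act p (0, 0) w = (k, of_int (threes p h))"
  shows "3 * h \<le> length w"
proof -
  define N where "N = length w"
  obtain c where c: "\<forall>i>2*N. c i = (0::int)" "(\<Sum>i\<le>2*N. \<bar>c i\<bar>) \<le> int (length w)"
     "real p ^ N * of_int (threes p h) = (\<Sum>i\<le>2*N. of_int (c i) * real p ^ i)"
    using act_expansion[of p w N] assms by (auto simp: N_def)
  \<comment> \<open>Large enough to cover both the positions up to \<open>2 * N\<close> and those
    below \<open>N + h\<close>.\<close>
  define M where "M = 2 * N + 1 + h"
  have ext: "(\<Sum>i<M. f i) = (\<Sum>i\<le>2*N. f i)" if "\<And>i. i > 2*N \<Longrightarrow> f i = 0" for f :: "nat \<Rightarrow> int"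
    by (rule sum.mono_neutral_right) (auto simp: M_def that)
  define d :: "nat \<Rightarrow> int" where "d = (\<lambda>i. if i \<in> {N..<N+h} then 3 else 0)"
  have restr: "(\<Sum>i<M. d i * f i) = (\<Sum>i<h. 3 * f (i + N))" for f :: "nat \<Rightarrow> int"
  proof -
    have "(\<Sum>i<M. d i * f i) = (\<Sum>i\<in>{N..<N+h}. 3 * f i)"
      by (rule sum.mono_neutral_cong_right) (auto simp: d_def M_def)
    also have "\<dots> = (\<Sum>i<h. 3 * f (i + N))"
      using sum.shift_bounds_nat_ivl[of "\<lambda>i. 3 * f i" 0 N h] by (simp add: atLeast0LessThan add.commute)
    finally show ?thesis .
  qed
  have "(of_int (int p ^ N * threes p h) :: real) = of_int (\<Sum>i\<le>2*N. c i * int p ^ i)"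
    using c(3) by simp
  then have "int p ^ N * threes p h = (\<Sum>i\<le>2*N. c i * int p ^ i)"
    by (simp only: of_int_eq_iff)
  moreover have "int p ^ N * threes p h = (\<Sum>i<M. d i * int p ^ i)"
    by (simp add: restr threes_def sum_distrib_left power_add mult.commute mult.left_commute)
  ultimately have "(\<Sum>i<M. c i * int p ^ i) = (\<Sum>i<M. d i * int p ^ i) + 0"
    using c(1) by (simp add: ext)
  then have "(\<Sum>i<M. d i) \<le> (\<Sum>i<M. \<bar>c i\<bar>) + \<bar>0\<bar>"
    using assms(1) by (intro digit_sum_bound[where p = "int p"]) (auto simp: d_def)
  moreover have "(\<Sum>i<M. \<bar>c i\<bar>) = (\<Sum>i\<le>2*N. \<bar>c i\<bar>)" using c(1) by (intro ext) auto
  moreover have "(\<Sum>i<M. d i) = 3 * int h" using restr[of "\<lambda>_. 1"] by simp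
  ultimately show ?thesis using c(2) by simp
qed

lemma threes_bounds:
  assumes "p \<ge> 7" "h \<ge> 1"
  shows "3 \<le> threes p h" "threes p h < int p ^ h"
proof -
  have "(\<Sum>i\<in>{0}. 3 * int p ^ i) \<le> threes p h"
    unfolding threes_def using assms by (intro sum_mono2) auto
  then show "3 \<le> threes p h" by simp
  \<comment> \<open>The factor 2 makes the induction close: \<open>p^h + 2 * 3 p^h = 7 p^h\<close>
    is at most \<open>p^(h + 1)\<close>.\<close>
  have "2 * threes p h < int p ^ h"
  proof (induction h)
    case 0
    show ?case by (simp add: threes_def)
  next
    case (Suc h)
    have "7 * int p ^ h \<le> int p * int p ^ h" using assms(1) by (intro mult_right_mono) auto
    with Suc show ?case by (simp add: threes_def)
  qed
  then show "threes p h < int p ^ h" using \<open>3 \<le> threes p h\<close> by linarith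
qed

subsection \<open>A map of the complex to the plane\<close>

text \<open>\<open>1 + p\<int>\<close> is one of the \<open>p\<close> cosets lying above the base coset \<open>\<int>\<close> in the Bass-Serre tree;
  \<open>branch\<close>, at positive height, describes the part of the tree above it. The side of a vertex is
  \<open>0\<close> on the base coset, \<open>-1\<close> above \<open>1 + p\<int>\<close>, and \<open>1\<close> on the rest of the tree.\<close>
definition branch :: "nat \<Rightarrow> real \<Rightarrow> bool" where
  "branch p b \<longleftrightarrow> (\<exists>m::int. b = 1 + real p * of_int m)"

definition side :: "nat \<Rightarrow> int \<times> real \<Rightarrow> real" where
  "side p x = (if fst x = 0 \<and> snd x \<in> \<int> then 0 else if fst x \<ge> 1 \<and> branch p (snd x) then -1 else 1)"

text \<open>The face based at height \<open>k\<close> has vertices at heights \<open>k\<close> and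
  \<open>k + 1\<close>, so the branch starts at \<open>k = 0\<close> for faces and at
  \<open>1\<close> for vertices.\<close>

definition face_side :: "nat \<Rightarrow> int \<times> real \<Rightarrow> real" where
  "face_side p x = (if fst x \<ge> 0 \<and> branch p (snd x) then -1 else 1)"

definition vmap :: "nat \<Rightarrow> int \<Rightarrow> int \<times> real \<Rightarrow> complex" where
  "vmap p c x = Complex (sgn (snd x - of_int c)) (side p x)"

fun skel_map :: "nat \<Rightarrow> int \<Rightarrow> pt \<Rightarrow> complex" where
  "skel_map p c (V g) = vmap p c (coords p g)"
| "skel_map p c (E g s u) = (1 - of_real u) * vmap p c (coords p g)
     + of_real u * vmap p c (step p (coords p g) (s, True))"
| "skel_map p c (F g z) = 0"

text \<open>At the centre \<open>sgn z = 0\<close> is not on the boundary circle and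
  \<open>skel_map\<close> takes its dummy value for faces, but the weight \<open>norm z\<close> is
  \<open>0\<close> there.\<close>

fun plane_map :: "nat \<Rightarrow> int \<Rightarrow> pt \<Rightarrow> complex" where
  "plane_map p c (F g z) = of_real (norm z) * skel_map p c (face_map p g (sgn z))
     + (1 - of_real (norm z)) * \<i> * of_real (face_side p (coords p g))"
| "plane_map p c x = skel_map p c x"

text \<open>The tent functions make continuity of the piecewise linear loop immediate.\<close>
definition boundary_loop :: "nat \<Rightarrow> int \<Rightarrow> bsg \<Rightarrow> real \<Rightarrow> complex" where
  "boundary_loop p c g y = (\<Sum>j\<le>p+3. of_real (max 0 (1 - \<bar>y - real j\<bar>))
     * vmap p c (act p (coords p g) (take j (rel_word p))))"

lemma skel_map_edge_map:
  assumes "p > 0" "g \<in> bs_group p" "0 \<le> u" "u \<le> 1"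
  shows "skel_map p c (edge_map p g s u) = (1 - of_real u) * vmap p c (coords p g)
     + of_real u * vmap p c (step p (coords p g) (s, True))"
  using assms by (auto simp: edge_map_def coords_rmul)

lemma plane_map_edge_map:
  assumes "p > 0" "g \<in> bs_group p" "u \<in> {0..1}"
  shows "plane_map p c (edge_map p g s u) = linepath (vmap p c (coords p g)) (vmap p c (step p (coords p g) (s, True))) u"
proof -
  have "plane_map p c (edge_map p g s u) = skel_map p c (edge_map p g s u)"
    by (auto simp: edge_map_def)
  with assms show ?thesis
    by (simp add: skel_map_edge_map linepath_def scaleR_conv_of_real)
qed

text \<open>Between \<open>j\<close> and \<open>j + 1\<close> only the tents at these two integers
  are nonzero.\<close>

lemma boundary_loop_segment:
  assumes "j < p + 3" "0 \<le> u" "u \<le> 1"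
  shows "boundary_loop p c g (real j + u)
    = (1 - of_real u) * vmap p c (act p (coords p g) (take j (rel_word p)))
      + of_real u * vmap p c (act p (coords p g) (take (Suc j) (rel_word p)))"
proof -
  let ?f = "\<lambda>i. of_real (max 0 (1 - \<bar>real j + u - real i\<bar>))
     * vmap p c (act p (coords p g) (take i (rel_word p)))"
  have "boundary_loop p c g (real j + u) = sum ?f {j, Suc j}"
    unfolding boundary_loop_def
  proof (rule sum.mono_neutral_right)
    show "\<forall>i\<in>{..p + 3} - {j, Suc j}. ?f i = 0"
    proof
      fix i assume "i \<in> {..p + 3} - {j, Suc j}"
      then have "real i + 1 \<le> real j \<or> real i \<ge> real j + 2" by auto
      then have "1 - \<bar>real j + u - real i\<bar> \<le> 0" using assms by linarith
      then show "?f i = 0" by (simp add: max_def)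
    qed
  qed (use assms in auto)
  also have "\<dots> = (1 - of_real u) * vmap p c (act p (coords p g) (take j (rel_word p)))
      + of_real u * vmap p c (act p (coords p g) (take (Suc j) (rel_word p)))"
    using assms by (simp add: max_def)
  finally show ?thesis .
qed

section \<open>The boundary of a face in polar coordinates\<close>

lemma length_rel_word [simp]: "length (rel_word p) = p + 3"
  by (simp add: rel_word_def)

lemma act_rel_word:
  assumes "p > 0" shows "act p x (rel_word p) = x"
  by (cases x) (simp add: rel_word_def act_replicate_GA powi_Suc assms)

lemma continuous_on_boundary_loop [continuous_intros]:
  "continuous_on S f \<Longrightarrow> continuous_on S (\<lambda>x. boundary_loop p c g (f x))"
  unfolding boundary_loop_def by (intro continuous_intros)

lemma coords_bvert:
  "p > 0 \<Longrightarrow> g \<in> bs_group p \<Longrightarrow> coords p (bvert p g j) = act p (coords p g) (take j (rel_word p))"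
  by (simp add: bvert_def coords_rmul)

lemma polar_frac: "z = of_real (norm z) * cis (2 * pi * frac (Arg z / (2 * pi)))"
proof -
  have "2 * pi * frac (Arg z / (2 * pi)) = Arg z + 2 * pi * of_int (- \<lfloor>Arg z / (2 * pi)\<rfloor>)"
    by (simp add: frac_def field_simps)
  then have "cis (2 * pi * frac (Arg z / (2 * pi))) = cis (Arg z)"
    by (metis cis_mult cis_multiple_2pi Ints_of_int mult.right_neutral)
  then show ?thesis using rcis_cmod_Arg[of z] by (simp add: rcis_def)
qed

lemma frac_Arg_cis:
  "frac (Arg (cis (2 * pi * x)) / (2 * pi)) = frac x"
proof -
  have "cis (Arg (cis (2 * pi * x))) = cis (2 * pi * x)"
    using cis_Arg[of "cis (2 * pi * x)"] by (simp add: sgn_eq)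
  then have "sin (Arg (cis (2 * pi * x))) = sin (2 * pi * x) \<and> cos (Arg (cis (2 * pi * x))) = cos (2 * pi * x)"
    by (metis cis.sel)
  then obtain n :: int where "Arg (cis (2 * pi * x)) = 2 * pi * x + 2 * pi * of_int n"
    by (auto simp: sin_cos_eq_iff)
  then have "Arg (cis (2 * pi * x)) / (2 * pi) = x + of_int n"
    by (simp add: field_simps)
  then show ?thesis by simp
qed

lemma face_map_norm1:
  assumes "p > 0" "g \<in> bs_group p" "norm z = 1"
  obtains g' s u where "face_map p g z = edge_map p g' s u" "g' \<in> bs_group p" "0 \<le> u" "u \<le> 1"
proof -
  define \<phi> where "\<phi> = real (p+3) * frac (Arg z / (2 * pi))"
  define j where "j = nat \<lfloor>\<phi>\<rfloor>"
  have *: "face_map p g z = (if snd (rel_word p ! j) then edge_map p (bvert p g j) (fst (rel_word p ! j)) (frac \<phi>)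
     else edge_map p (bvert p g (j+1)) (fst (rel_word p ! j)) (1 - frac \<phi>))"
    using assms(3) unfolding \<phi>_def j_def by (simp add: face_map_def Let_def)
  show ?thesis
  proof (cases "snd (rel_word p ! j)")
    case True
    show ?thesis
      by (rule that[of "bvert p g j" "fst (rel_word p ! j)" "frac \<phi>"])
         (use * True assms in \<open>auto simp: bvert_in_group less_imp_le[OF frac_lt_1]\<close>)
  next
    case False
    show ?thesis
      by (rule that[of "bvert p g (j+1)" "fst (rel_word p ! j)" "1 - frac \<phi>"])
         (use * False assms in \<open>auto simp: bvert_in_group less_imp_le[OF frac_lt_1]\<close>)
  qed
qed

lemma skel_map_boundary:
  assumes p: "p > 0" and g: "g \<in> bs_group p" and x: "0 \<le> x" "x \<le> 1"
  shows "skel_map p c (face_map p g (cis (2 * pi * x))) = boundary_loop p c g (real (p + 3) * x)"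
proof -
  define \<phi> where "\<phi> = real (p + 3) * frac x"
  define j where "j = nat \<lfloor>\<phi>\<rfloor>"
  define l where "l = rel_word p ! j"
  have \<phi>: "0 \<le> \<phi>" "\<phi> < real (p + 3)"
    using frac_lt_1[of x] by (auto simp: \<phi>_def)
  have j: "j < p + 3" "\<phi> = real j + frac \<phi>"
    using \<phi> unfolding j_def by (auto simp: frac_def) linarith
  have Suc: "act p (coords p g) (take (Suc j) (rel_word p)) = step p (act p (coords p g) (take j (rel_word p))) l"
    using j(1) by (simp add: take_Suc_conv_app_nth l_def)
  have fm: "face_map p g (cis (2 * pi * x)) = (if snd l then edge_map p (bvert p g j) (fst l) (frac \<phi>)
     else edge_map p (bvert p g (j+1)) (fst l) (1 - frac \<phi>))"
    unfolding face_map_def frac_Arg_cis by (simp add: Let_def \<phi>_def j_def l_def)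
  have "skel_map p c (face_map p g (cis (2 * pi * x))) = boundary_loop p c g (real j + frac \<phi>)"
  proof (cases "snd l")
    case True
    then have "(fst l, True) = l" by (cases l) auto
    with True show ?thesis
      using p g by (simp add: fm skel_map_edge_map bvert_in_group coords_bvert Suc less_imp_le[OF frac_lt_1]
        boundary_loop_segment[OF j(1)])
  next
    case False
    \<comment> \<open>The edge of an inverse letter is parametrised from its far end, where the
      positive generator undoes the letter.\<close>
    then have "(fst l, True) = inv_letter l" by (simp add: inv_letter_def)
    with False show ?thesis
      using p g by (simp add: fm skel_map_edge_map bvert_in_group coords_bvert Suc step_cancel
         less_imp_le[OF frac_lt_1] boundary_loop_segment[OF j(1)])
  qed
  also have "\<dots> = boundary_loop p c g (real (p + 3) * x)"
  proof (cases "x = 1")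
    \<comment> \<open>At \<open>x = 1\<close> the fractional part restarts at the base vertex; the
      loop agrees because the relator acts trivially.\<close>
    case True
    have "boundary_loop p c g (real (p + 2) + 1) = boundary_loop p c g (real 0 + 0)"
      using boundary_loop_segment[of "p+2" p 1 c g] boundary_loop_segment[of 0 p 0 c g] act_rel_word[OF p]
      by simp
    with True j(2) show ?thesis by (simp add: \<phi>_def add.commute)
  next
    case False
    with x have "frac x = x" by (simp add: frac_eq)
    with j(2) show ?thesis by (simp add: \<phi>_def)
  qed
  finally show ?thesis .
qed

text \<open>One formula covers centre, interior and circle, which reduces continuity on the closed
  disc to continuity in \<open>r\<close> and \<open>x\<close>.\<close>

lemma plane_map_cone:
  assumes "p > 0" "g \<in> bs_group p" "0 \<le> x" "x \<le> 1" "0 \<le> r" "r \<le> 1"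
  shows "plane_map p c (face_map p g (of_real r * cis (2 * pi * x)))
    = of_real r * boundary_loop p c g (real (p + 3) * x) + (1 - of_real r) * \<i> * of_real (face_side p (coords p g))"
proof -
  consider "r = 0" | "0 < r" "r < 1" | "r = 1" using assms by linarith
  then show ?thesis
  proof cases
    case 1
    then show ?thesis by (simp add: face_map_def)
  next
    case 2
    then have "face_map p g (of_real r * cis (2 * pi * x)) = F g (of_real r * cis (2 * pi * x))"
      by (simp add: face_map_def norm_mult)
    moreover have "sgn (of_real r * cis (2 * pi * x)) = cis (2 * pi * x)"
      using 2 by (simp add: sgn_mult sgn_of_real)
    ultimately show ?thesis using 2 assms by (simp add: norm_mult skel_map_boundary)
  next
    case 3
    obtain g' s u where e: "face_map p g (cis (2 * pi * x)) = edge_map p g' s u"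
      using face_map_norm1[OF assms(1,2)] by (metis norm_cis)
    have "plane_map p c (edge_map p g' s u) = skel_map p c (edge_map p g' s u)"
      by (auto simp: edge_map_def)
    with e 3 show ?thesis using skel_map_boundary[OF assms(1-4), of c] by simp
  qed
qed

lemma continuous_on_plane_map_face:
  assumes "p > 0" "g \<in> bs_group p"
  shows "continuous_on (cball 0 1) (\<lambda>z. plane_map p c (face_map p g z))"
proof -
  let ?D = "{0..1::real} \<times> {0..1::real}"
  let ?e = "\<lambda>(r, x). complex_of_real r * cis (2 * pi * x)"
  have e: "continuous_on ?D ?e"
    by (auto simp: case_prod_unfold intro!: continuous_intros)
  have im: "?e ` ?D = cball 0 1"
  proof
    show "?e ` ?D \<subseteq> cball 0 1" by (auto simp: norm_mult)
    show "cball 0 1 \<subseteq> ?e ` ?D"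
    proof
      fix z :: complex assume "z \<in> cball 0 1"
      define x where "x = frac (Arg z / (2 * pi))"
      have "z = ?e (norm z, x)" using polar_frac[of z] by (simp add: x_def)
      moreover have "(norm z, x) \<in> ?D"
        using \<open>z \<in> cball 0 1\<close> by (auto simp: x_def less_imp_le[OF frac_lt_1])
      ultimately show "z \<in> ?e ` ?D" by blast
    qed
  qed
  \<comment> \<open>Polar coordinates are a quotient map, so neither the cut of \<open>Arg\<close> nor the cone point needs care.\<close>
  have q: "quotient_map (top_of_set ?D) (top_of_set (cball 0 1)) ?e"
    using e im by (intro continuous_imp_quotient_map)
      (auto simp: compact_space_subtopology compact_Times Hausdorff_space_subtopology)
  have "continuous_on ?D (\<lambda>y. of_real (fst y) * boundary_loop p c g (real (p + 3) * snd y)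
      + (1 - of_real (fst y)) * \<i> * of_real (face_side p (coords p g)))"
    by (intro continuous_intros)
  then have "continuous_on ?D ((\<lambda>z. plane_map p c (face_map p g z)) \<circ> ?e)"
    using assms by (subst continuous_on_cong[OF refl]) (auto simp: plane_map_cone)
  then have "continuous_map (top_of_set ?D) euclidean ((\<lambda>z. plane_map p c (face_map p g z)) \<circ> ?e)"
    by simp
  from continuous_compose_quotient_map[OF q this] show ?thesis by simp
qed

section \<open>The cell topology and continuity of the map\<close>

lemma edge_map_in_X1:
  "g \<in> bs_group p \<Longrightarrow> edge_map p g s u \<in> cx_X1 p"
  by (auto simp: edge_map_def cx_X1_def bs_rmul_in_group)

lemma cx_X1_subset: "cx_X1 p \<subseteq> cx_points p"
  by (auto simp: cx_X1_def cx_points_def)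

lemma face_map_in_points:
  assumes "p > 0" "g \<in> bs_group p" "z \<in> cball 0 1"
  shows "face_map p g z \<in> cx_points p"
proof (cases "norm z < 1")
  case True
  with assms show ?thesis by (auto simp: face_map_def cx_points_def)
next
  case False
  with assms have "norm z = 1" by simp
  then obtain g' s u where "face_map p g z = edge_map p g' s u" "g' \<in> bs_group p"
    using face_map_norm1[OF assms(1,2)] by metis
  then show ?thesis using edge_map_in_X1 cx_X1_subset by (metis subsetD)
qed

lemma openin_cx_top: "openin (cx_top p) U \<longleftrightarrow> cx_open p U"
  by (simp add: cx_top_def topology_inverse' istopology_cx_open)

lemma topspace_cx_top:
  assumes "p > 0" shows "topspace (cx_top p) = cx_points p"
proof -
  have edge: "{u \<in> {0..1}. edge_map p g s u \<in> cx_points p} = {0..1}" if "g \<in> bs_group p" for g s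
    using edge_map_in_X1[OF that] cx_X1_subset by blast
  have face: "{z \<in> cball 0 1. face_map p g z \<in> cx_points p} = cball 0 1" if "g \<in> bs_group p" for g
    using face_map_in_points[OF assms that] by blast
  have "openin (cx_top p) (cx_points p)"
    unfolding openin_cx_top cx_open_def by (auto simp only: edge face openin_subtopology_self)
  moreover have "U \<subseteq> cx_points p" if "openin (cx_top p) U" for U
    using that by (simp add: openin_cx_top cx_open_def)
  ultimately show ?thesis by (meson openin_subset openin_topspace subset_antisym)
qed

lemma continuous_map_edge_map:
  assumes "p > 0" "g \<in> bs_group p"
  shows "continuous_map (top_of_set {0..1}) (subtopology (cx_top p) (cx_X1 p)) (edge_map p g s)"
proof (rule continuous_map_into_subtopology)
  show "continuous_map (top_of_set {0..1}) (cx_top p) (edge_map p g s)"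
    unfolding continuous_map_def topspace_cx_top[OF assms(1)] openin_cx_top
    using assms(2) edge_map_in_X1[OF assms(2)] cx_X1_subset by (auto simp: cx_open_def)
qed (use assms(2) edge_map_in_X1 in auto)

text \<open>The complex carries the weak topology, so preimages are tested through
  \<open>edge_map\<close> and \<open>face_map\<close> alone.\<close>

lemma continuous_map_plane_map:
  assumes "p > 0" shows "continuous_map (cx_top p) euclidean (plane_map p c)"
  unfolding continuous_map topspace_cx_top[OF assms] openin_cx_top open_openin[symmetric]
proof (intro conjI allI impI)
  fix U :: "complex set" assume U: "open U"
  show "cx_open p {x \<in> cx_points p. plane_map p c x \<in> U}"
    unfolding cx_open_def
  proof (intro conjI ballI allI)
    fix g s assume g: "g \<in> bs_group p"
    have "continuous_on {0..1} (\<lambda>u. plane_map p c (edge_map p g s u))"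
      by (subst continuous_on_cong[OF refl plane_map_edge_map[OF assms g]]) (auto intro!: continuous_intros)
    from continuous_openin_preimage_gen[OF this U]
    have "openin (top_of_set {0..1}) ({0..1} \<inter> (\<lambda>u. plane_map p c (edge_map p g s u)) -` U)" .
    moreover have "{0..1} \<inter> (\<lambda>u. plane_map p c (edge_map p g s u)) -` U
      = {u \<in> {0..1}. edge_map p g s u \<in> {x \<in> cx_points p. plane_map p c x \<in> U}}"
      using edge_map_in_X1[OF g] cx_X1_subset by blast
    ultimately show "openin (top_of_set {0..1}) {u \<in> {0..1}. edge_map p g s u \<in> {x \<in> cx_points p. plane_map p c x \<in> U}}"
      by simp
  next
    fix g assume g: "g \<in> bs_group p"
    from continuous_openin_preimage_gen[OF continuous_on_plane_map_face[OF assms g] U]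
    have "openin (top_of_set (cball 0 1)) (cball 0 1 \<inter> (\<lambda>z. plane_map p c (face_map p g z)) -` U)" .
    moreover have "cball 0 1 \<inter> (\<lambda>z. plane_map p c (face_map p g z)) -` U
      = {z \<in> cball 0 1. face_map p g z \<in> {x \<in> cx_points p. plane_map p c x \<in> U}}"
      using face_map_in_points[OF assms g] by blast
    ultimately show "openin (top_of_set (cball 0 1)) {z \<in> cball 0 1. face_map p g z \<in> {x \<in> cx_points p. plane_map p c x \<in> U}}"
      by simp
  qed auto
qed auto

subsection \<open>The zero of the map\<close>

text \<open>For \<open>k \<ge> 1\<close> the translation is by a multiple of \<open>p\<close>, which
  preserves the coset of 1.\<close>

lemma branch_shift:
  assumes "k \<ge> 1" "p > 0"
  shows "branch p (b + of_int m * real p powi k) \<longleftrightarrow> branch p b"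
proof -
  have "real p powi k = real p * of_int (int p ^ nat (k - 1))"
    using assms powi_Suc[of p "k - 1"] by (simp add: power_int_def)
  then have shift: "b + of_int m * real p powi k = 1 + real p * of_int (n + m * int p ^ nat (k - 1))"
    if "b = 1 + real p * of_int n" for b m n
    using that by (simp add: algebra_simps)
  \<comment> \<open>The converse is the same shift with \<open>-m\<close>.\<close>
  show ?thesis
    using shift[of b _ m] shift[of "b + of_int m * real p powi k" _ "-m"]
    unfolding branch_def by (metis add_diff_cancel_right' diff_conv_add_uminus mult_minus_left of_int_minus)
qed

lemma branch_Ints: "branch p b \<Longrightarrow> b \<in> \<int>"
  by (auto simp: branch_def)

text \<open>The vertices of a face lie in two adjacent cosets. Neither has the side opposite to the
  face: above height 0 \<open>branch_shift\<close> applies, on the base coset the side is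
  \<open>0\<close>, and elsewhere every side is \<open>1\<close>.\<close>

lemma face_side_vertex:
  assumes "p > 0"
  shows "0 \<le> face_side p (k, b) * side p (k, b + of_int m * real p powi k)"
    and "0 \<le> face_side p (k, b) * side p (k + 1, b + of_int m * real p powi (k + 1))"
proof -
  show "0 \<le> face_side p (k, b) * side p (k, b + of_int m * real p powi k)"
    using branch_shift[of k p b m] assms branch_Ints[of p b]
    by (cases "k = 0") (auto simp: face_side_def side_def)
  show "0 \<le> face_side p (k, b) * side p (k + 1, b + of_int m * real p powi (k + 1))"
    using branch_shift[of "k + 1" p b m] assms
    by (auto simp: face_side_def side_def)
qed

text \<open>The branch is separated from the rest of the tree by the base coset, where the side is
  \<open>0\<close>.\<close>

lemma side_step_same_sign:
  assumes "p > 0" shows "0 \<le> side p x * side p (step p x (s, True))"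
proof (cases x)
  case (Pair k b)
  show ?thesis
  proof (cases s)
    case GA
    then show ?thesis using Pair branch_shift[of k p b 1] assms
      by (auto simp: side_def)
  next
    case GT
    then show ?thesis using Pair branch_Ints[of p b] by (auto simp: side_def)
  qed
qed

lemma face_side_boundary:
  assumes "p > 0"
  shows "0 \<le> face_side p x * side p (act p x (take j (rel_word p)))"
proof -
  obtain k b where x: "x = (k, b)" by (meson surj_pair)
  have "j = 0 \<or> j = 1 \<or> j = 2 \<or> (\<exists>i. j = i + 3)" by presburger
  then consider "j = 0" | "j = 1" | "j = 2" | i where "j = i + 3" by blast
  then show ?thesis
  proof cases
    case 1
    then show ?thesis using face_side_vertex(1)[OF assms, of k b 0] by (simp add: x)
  next
    case 2
    then show ?thesis using face_side_vertex(2)[OF assms, of k b 0] by (simp add: x rel_word_def)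
  next
    case 3
    then show ?thesis using face_side_vertex(2)[OF assms, of k b 1]
      by (simp add: x rel_word_def numeral_2_eq_2)
  next
    case 4
    \<comment> \<open>The prefix \<open>t a t^-1\<close> adds \<open>p * p^k\<close> and each later
      letter removes \<open>p^k\<close>; \<open>min\<close> accounts for \<open>j\<close> beyond the
      end of the word.\<close>
    then have "act p x (take j (rel_word p)) = (k, b + of_int (int p - int (min i p)) * real p powi k)"
      using powi_Suc[OF assms, of k]
      by (simp add: x rel_word_def numeral_3_eq_3 take_replicate act_replicate_GA left_diff_distrib)
    then show ?thesis using face_side_vertex(1)[OF assms, of k b "int p - int (min i p)"]
      unfolding x by presburger
  qed
qed

text \<open>The imaginary part puts both ends on the base line. Consecutive integers never lie
  strictly on opposite sides of \<open>c\<close>, so the real part cannot cancel inside the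
  edge.\<close>

lemma edge_nonzero:
  assumes p: "p > 0" and u: "0 < u" "u < 1"
  shows "(1 - of_real u) * vmap p c x + of_real u * vmap p c (step p x (s, True)) \<noteq> 0"
proof
  assume eq: "(1 - of_real u) * vmap p c x + of_real u * vmap p c (step p x (s, True)) = 0"
  let ?y = "step p x (s, True)"
  have "(1 - u) * side p x + u * side p ?y = 0"
    using arg_cong[OF eq, of Im] by (simp add: vmap_def)
  moreover have "side p x \<in> {-1, 0, 1}" "side p ?y \<in> {-1, 0, 1}" by (auto simp: side_def)
  ultimately have z: "side p x = 0" "side p ?y = 0"
    using u side_step_same_sign[OF p, of x s] by auto
  from z(1) obtain n :: int where x: "x = (0, of_int n)"
    by (cases x) (auto simp: side_def elim!: Ints_cases split: if_splits)
  with z(2) have s: "s = GA" by (cases s) (auto simp: side_def split: if_splits)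
  have "(1 - u) * sgn (of_int n - of_int c) + u * sgn (of_int n + 1 - of_int c) = (0::real)"
    using arg_cong[OF eq, of Re] by (simp add: vmap_def x s)
  moreover have "n \<le> c - 2 \<or> n = c - 1 \<or> n = c \<or> n \<ge> c + 1" by linarith
  ultimately show False using u
    by (auto simp: sgn_if split: if_splits)
qed

text \<open>On a face the boundary loop lies in the closed half plane of the apex, so the imaginary
  part times the side is at least \<open>1 - r > 0\<close>.\<close>

lemma plane_map_eq_0:
  assumes p: "p > 0" and x: "x \<in> cx_points p" and eq: "plane_map p c x = 0"
  obtains g where "x = V g" "g \<in> bs_group p" "coords p g = (0, of_int c)"
proof -
  from x consider (V) g where "x = V g" "g \<in> bs_group p"
    | (E) g s u where "x = E g s u" "0 < u" "u < 1"
    | (F) g z where "x = F g z" "g \<in> bs_group p" "norm z < 1"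
    by (auto simp: cx_points_def)
  then show ?thesis
  proof cases
    case V
    with eq have "sgn (snd (coords p g) - of_int c) = 0" "side p (coords p g) = 0"
      by (auto simp: vmap_def complex_eq_iff)
    then have "coords p g = (0, of_int c)"
      by (cases "coords p g") (auto simp: sgn_if side_def split: if_splits)
    with V that show ?thesis by blast
  next
    case E
    with eq edge_nonzero[OF p] show ?thesis by simp
  next
    case F
    define \<eta> where "\<eta> = face_side p (coords p g)"
    have \<eta>: "\<eta> * \<eta> = 1" by (simp add: \<eta>_def face_side_def)
    have nz: "0 \<le> \<eta> * Im (boundary_loop p c g y)" for y
    proof -
      have "\<eta> * Im (boundary_loop p c g y) = (\<Sum>j\<le>p+3. max 0 (1 - \<bar>y - real j\<bar>)
        * (\<eta> * side p (act p (coords p g) (take j (rel_word p)))))"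
        unfolding boundary_loop_def by (simp add: sum_distrib_left vmap_def algebra_simps)
      also have "\<dots> \<ge> 0"
        unfolding \<eta>_def by (intro sum_nonneg mult_nonneg_nonneg[OF _ face_side_boundary[OF p]]) auto
      finally show ?thesis .
    qed
    obtain r y where ry: "z = of_real r * cis (2 * pi * y)" "0 \<le> r" "r < 1" "0 \<le> y" "y \<le> 1"
      using that[OF polar_frac] F by (simp add: less_imp_le[OF frac_lt_1])
    have "plane_map p c (face_map p g z) = 0" using F eq by (simp add: face_map_def)
    then have "of_real r * boundary_loop p c g (real (p + 3) * y) + (1 - of_real r) * \<i> * of_real \<eta> = 0"
      using plane_map_cone[OF p F(2), of y r c] ry by (simp add: \<eta>_def)
    from arg_cong[OF this, of Im] have "r * Im (boundary_loop p c g (real (p + 3) * y)) + (1 - r) * \<eta> = 0"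
      by simp
    then have "\<eta> * (r * Im (boundary_loop p c g (real (p + 3) * y)) + (1 - r) * \<eta>) = 0" by simp
    then have "r * (\<eta> * Im (boundary_loop p c g (real (p + 3) * y))) + (1 - r) * (\<eta> * \<eta>) = 0"
      by (simp add: algebra_simps)
    moreover have "0 \<le> r * (\<eta> * Im (boundary_loop p c g (real (p + 3) * y)))"
      using nz ry by simp
    ultimately show ?thesis using \<eta> ry by simp
  qed
qed

subsection \<open>Winding numbers along the combing\<close>

text \<open>The two ways around the square from \<open>(0, 0)\<close> to \<open>(1, 1)\<close> are
  homotopic, and the constant bottom side contributes nothing.\<close>

lemma winding_number_square:
  fixes K :: "real \<times> real \<Rightarrow> complex"
  assumes K: "continuous_on ({0..1} \<times> {0..1}) K" "\<And>u t. u \<in> {0..1} \<Longrightarrow> t \<in> {0..1} \<Longrightarrow> K (u, t) \<noteq> 0"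
    and bot: "\<And>u. u \<in> {0..1} \<Longrightarrow> K (u, 0) = a"
    and top: "\<And>u. u \<in> {0..1} \<Longrightarrow> K (u, 1) = linepath x y u"
  shows "winding_number (\<lambda>t. K (1, t)) 0 = winding_number (\<lambda>t. K (0, t)) 0 + winding_number (linepath x y) 0"
proof -
  let ?D = "{0..1::real} \<times> {0..1::real}"
  have cvx: "convex ?D" by (intro convex_Times) auto
  define P Q where "P = linepath (0::real, 0::real) (0, 1) +++ linepath (0, 1) (1, 1)"
    and "Q = linepath (0::real, 0::real) (1, 0) +++ linepath (1, 0) (1, 1)"
  have seg: "path_image (linepath v w) \<subseteq> ?D" if "v \<in> ?D" "w \<in> ?D" for v w
    using closed_segment_subset[OF that cvx] by simp
  have sub: "path_image P \<subseteq> ?D" "path_image Q \<subseteq> ?D"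
    unfolding P_def Q_def by (intro subset_path_image_join seg; simp)+
  have "homotopic_paths ?D P Q"
  proof (rule homotopic_paths_linear)
    fix t :: real assume "t \<in> {0..1}"
    then have "P t \<in> ?D" "Q t \<in> ?D" using sub unfolding path_image_def by blast+
    then show "closed_segment (P t) (Q t) \<subseteq> ?D" by (rule closed_segment_subset[OF _ _ cvx])
  qed (auto simp: P_def Q_def)
  then have "homotopic_paths (-{0}) (K \<circ> P) (K \<circ> Q)"
    by (rule homotopic_paths_continuous_image) (use K in auto)
  then have wn: "winding_number (K \<circ> P) 0 = winding_number (K \<circ> Q) 0"
    by (rule winding_number_homotopic_paths)
  have good: "path (K \<circ> linepath v w)" "0 \<notin> path_image (K \<circ> linepath v w)" if "v \<in> ?D" "w \<in> ?D" for v w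
    using seg[OF that] K
    by (auto intro!: path_continuous_image continuous_on_subset[OF K(1)] simp: path_image_compose)
  have split: "winding_number (K \<circ> (linepath u v +++ linepath v w)) 0
      = winding_number (K \<circ> linepath u v) 0 + winding_number (K \<circ> linepath v w) 0"
    if "u \<in> ?D" "v \<in> ?D" "w \<in> ?D" for u v w
    unfolding path_compose_join using that
    by (intro winding_number_join good) (auto simp: pathfinish_compose pathstart_compose)
  have cong: "winding_number g 0 = winding_number h 0"
    if "path g" "0 \<notin> path_image g" "\<And>t. t \<in> {0..1} \<Longrightarrow> g t = h t" for g h
    by (rule winding_number_homotopic_paths, rule homotopic_paths_eq) (use that in auto)
  have "winding_number (K \<circ> linepath (0,0) (1,0)) 0 = winding_number (linepath a a) 0"
    by (rule cong[OF good]) (use bot in \<open>auto simp: linepath_def scaleR_conv_of_real algebra_simps\<close>)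
  also have "\<dots> = 0"
    using K(2)[of 0 0] bot[of 0] by (intro winding_number_trivial) auto
  finally have 1: "winding_number (K \<circ> linepath (0,0) (1,0)) 0 = 0" .
  have 2: "winding_number (K \<circ> linepath (0,1) (1,1)) 0 = winding_number (linepath x y) 0"
    by (rule cong[OF good]) (use top in \<open>auto simp: linepath_def[of "(_, _)"]\<close>)
  have 3: "K \<circ> linepath (0,0) (0,1) = (\<lambda>t. K (0, t))" "K \<circ> linepath (1,0) (1,1) = (\<lambda>t. K (1, t))"
    by (auto simp: linepath_def fun_eq_iff)
  show ?thesis
    using wn split[of "(0,0)" "(0,1)" "(1,1)"] split[of "(0,0)" "(1,0)" "(1,1)"] 1 2 3
    by (simp add: P_def Q_def)
qed

text \<open>Combing paths need not be closed, so this is a complex number: the change of the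
  logarithm divided by \<open>2 * pi * \<i>\<close>.\<close>

definition spoke_winding :: "nat \<Rightarrow> int \<Rightarrow> (pt \<times> real \<Rightarrow> pt) \<Rightarrow> bsg \<Rightarrow> complex" where
  "spoke_winding p c \<Psi> g = winding_number (\<lambda>t. plane_map p c (\<Psi> (V g, t))) 0"

text \<open>Combing the points of an edge gives a square with constant bottom, the edge itself on
  top and the two spokes as vertical sides.\<close>

lemma spoke_winding_edge:
  assumes p: "p > 0" and comb: "is_1_combing p \<Psi>" and g: "g \<in> bs_group p"
    and nz: "\<And>u t. u \<in> {0..1} \<Longrightarrow> t \<in> {0..1} \<Longrightarrow> plane_map p c (\<Psi> (edge_map p g s u, t)) \<noteq> 0"
  defines "x \<equiv> vmap p c (coords p g)" and "y \<equiv> vmap p c (step p (coords p g) (s, True))"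
  shows "spoke_winding p c \<Psi> (bs_rmul p g [(s, True)])
      = spoke_winding p c \<Psi> g + winding_number (linepath x y) 0"
    and "0 \<notin> path_image (linepath x y)"
proof -
  let ?I = "top_of_set {0..1::real}"
  define K where "K = (\<lambda>(u, t). plane_map p c (\<Psi> (edge_map p g s u, t)))"
  have X1: "edge_map p g s u \<in> cx_X1 p" for u by (rule edge_map_in_X1[OF g])
  have "continuous_map (prod_topology ?I ?I) (prod_topology (subtopology (cx_top p) (cx_X1 p)) ?I)
      (\<lambda>y. (edge_map p g s (fst y), snd y))"
    by (intro continuous_map_pairedI continuous_map_snd
        continuous_map_compose[OF continuous_map_fst continuous_map_edge_map[OF p g], unfolded comp_def])
  moreover have "continuous_map (prod_topology (subtopology (cx_top p) (cx_X1 p)) ?I) (cx_top p) \<Psi>"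
    using comb by (simp add: is_1_combing_def)
  ultimately have "continuous_map (prod_topology ?I ?I) euclidean
      (plane_map p c \<circ> (\<Psi> \<circ> (\<lambda>y. (edge_map p g s (fst y), snd y))))"
    by (intro continuous_map_compose[OF _ continuous_map_plane_map[OF p]] continuous_map_compose)
  moreover have "prod_topology ?I ?I = top_of_set ({0..1} \<times> {0..1})"
    by (metis prod_topology_euclidean subtopology_Times)
  ultimately have cont: "continuous_on ({0..1} \<times> {0..1}) K"
    by (simp add: K_def case_prod_unfold comp_def)
  have top: "K (u, 1) = linepath x y u" if "u \<in> {0..1}" for u
    using comb X1 that unfolding is_1_combing_def K_def x_def y_def
    by (simp add: plane_map_edge_map[OF p g])
  have "winding_number (\<lambda>t. K (1, t)) 0 = winding_number (\<lambda>t. K (0, t)) 0 + winding_number (linepath x y) 0"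
  proof (rule winding_number_square[OF cont _ _ top])
    show "K (u, 0) = plane_map p c (V (bs_one p))" for u
      using comb X1 by (simp add: is_1_combing_def K_def)
  qed (use nz in \<open>auto simp: K_def\<close>)
  then show "spoke_winding p c \<Psi> (bs_rmul p g [(s, True)])
      = spoke_winding p c \<Psi> g + winding_number (linepath x y) 0"
    by (simp add: spoke_winding_def K_def edge_map_def)
  have "linepath x y u \<noteq> 0" if "u \<in> {0..1}" for u
    using nz[OF that, of 1] top[OF that] by (simp add: K_def)
  then show "0 \<notin> path_image (linepath x y)" unfolding path_image_def by (metis imageE)
qed

section \<open>Consequences of radial tameness\<close>

lemma combing_level_bound:
  assumes comb: "is_1_combing p \<Psi>" and rad: "radial_tameness_function p \<Psi> (\<lambda>q. q + C)"
    and x: "x \<in> cx_X1 p" and t: "0 \<le> t" "t \<le> 1"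
  shows "lev p (\<Psi> (x, t)) \<le> lev p x + max C 0"
proof (rule ccontr)
  assume *: "\<not> ?thesis"
  have 1: "\<Psi> (x, 1) = x" using comb x by (simp add: is_1_combing_def)
  \<comment> \<open>Taking the maximum with \<open>0\<close> settles \<open>t = 1\<close> for
    negative \<open>C\<close> as well, so tameness is applied from \<open>t < 1\<close> to time
    \<open>1\<close>.\<close>
  with * have "t \<noteq> 1" by auto
  have "lev p x < lev p (\<Psi> (x, t)) - max C 0" using * by simp
  then obtain q where q: "q \<in> \<rat>" "lev p x < q" "q < lev p (\<Psi> (x, t)) - max C 0"
    using Rats_dense_in_real by blast
  then have "lev p (\<Psi> (x, t)) > q + C" by linarith
  then have "lev p (\<Psi> (x, 1)) > q"
    using rad x t \<open>t \<noteq> 1\<close> q(1) unfolding radial_tameness_function_def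
    by (metis less_eq_real_def order_refl)
  with 1 q show False by simp
qed


lemma lev_edge_map_le:
  assumes "g \<in> bs_group p" "real (bs_wlen p g) \<le> L" "real (bs_wlen p (bs_rmul p g [(s, True)])) \<le> L"
  shows "lev p (edge_map p g s u) \<le> L + 1/4"
  using assms by (auto simp: edge_map_def lev_def field_simps)

text \<open>A zero would be a vertex with the coordinates of \<open>a^c\<close>, whose level is at
  least \<open>3 * h\<close>, beyond the reach of the combing.\<close>

lemma combing_avoids_zero:
  assumes p: "p \<ge> 7" and comb: "is_1_combing p \<Psi>" and rad: "radial_tameness_function p \<Psi> (\<lambda>q. q + C)"
    and x: "x \<in> cx_X1 p" "lev p x + max C 0 < 3 * real h" and t: "t \<in> {0..1}"
  shows "plane_map p (threes p h) (\<Psi> (x, t)) \<noteq> 0"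
proof
  assume eq: "plane_map p (threes p h) (\<Psi> (x, t)) = 0"
  have p0: "p > 0" using p by simp
  have "continuous_map (prod_topology (subtopology (cx_top p) (cx_X1 p)) (top_of_set {0..1})) (cx_top p) \<Psi>"
    using comb by (simp add: is_1_combing_def)
  then have "\<Psi> (x, t) \<in> topspace (cx_top p)"
    using x t cx_X1_subset[of p] by (auto simp: continuous_map_def topspace_cx_top[OF p0] Pi_iff)
  then obtain g where g: "\<Psi> (x, t) = V g" "g \<in> bs_group p" "coords p g = (0, of_int (threes p h))"
    using plane_map_eq_0[OF p0 _ eq] by (auto simp: topspace_cx_top[OF p0])
  obtain w where w: "bs_elem p w = g" "length w = bs_wlen p g"
    using bs_wlen_attained[OF g(2)] .
  then have "3 * h \<le> bs_wlen p g" using threes_length_bound[OF p, of w 0 h] g p0 by auto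
  then have "3 * real h \<le> real (bs_wlen p g)" by linarith
  moreover have "real (bs_wlen p g) \<le> lev p x + max C 0"
    using combing_level_bound[OF comb rad x(1), of t] t g(1) by (simp add: lev_def)
  ultimately show False using x by linarith
qed

text \<open>In \<open>5/4\<close>, the \<open>1\<close> is for the appended letter and
  \<open>1/4\<close> for the extra level of edge interiors.\<close>

lemma spoke_winding_snoc:
  assumes p: "p \<ge> 7" and comb: "is_1_combing p \<Psi>" and rad: "radial_tameness_function p \<Psi> (\<lambda>q. q + C)"
    and w: "real (length w) + 5/4 + max C 0 < 3 * real h"
  defines "W \<equiv> \<lambda>w. spoke_winding p (threes p h) \<Psi> (bs_elem p w)"
    and "P \<equiv> \<lambda>w. vmap p (threes p h) (act p (0, 0) w)"
  shows "W (w @ [l]) = W w + winding_number (linepath (P w) (P (w @ [l]))) 0"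
proof -
  have p0: "p > 0" using p by simp
  have edge: "W (v @ [(s, True)]) = W v + winding_number (linepath (P v) (P (v @ [(s, True)]))) 0
      \<and> 0 \<notin> path_image (linepath (P v) (P (v @ [(s, True)])))"
    if "real (bs_wlen p (bs_elem p v)) \<le> real (length w) + 1"
       "real (bs_wlen p (bs_elem p (v @ [(s, True)]))) \<le> real (length w) + 1" for v s
  proof -
    have "lev p (edge_map p (bs_elem p v) s u) \<le> real (length w) + 1 + 1/4" for u
      using that by (intro lev_edge_map_le) auto
    moreover have "real (length w) + 1 + 1/4 + max C 0 < 3 * real h" using w by simp
    ultimately have "lev p (edge_map p (bs_elem p v) s u) + max C 0 < 3 * real h" for u
      by (meson add_right_mono le_less_trans)
    then have "plane_map p (threes p h) (\<Psi> (edge_map p (bs_elem p v) s u, t)) \<noteq> 0" if "t \<in> {0..1}" for u t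
      using that by (intro combing_avoids_zero[OF p comb rad] edge_map_in_X1) auto
    then show ?thesis
      using spoke_winding_edge[OF p0 comb, of "bs_elem p v" "threes p h" s] p0
      by (simp add: W_def P_def)
  qed
  have wl: "real (bs_wlen p (bs_elem p w)) \<le> real (length w) + 1"
       "real (bs_wlen p (bs_elem p (w @ [l]))) \<le> real (length w) + 1"
    using bs_wlen_le[of p w] bs_wlen_le[of p "w @ [l]"] by auto
  obtain s b where l: "l = (s, b)" by (cases l)
  show ?thesis
  proof (cases b)
    case True
    with edge[of w s] wl l show ?thesis by simp
  next
    case False
    \<comment> \<open>An inverse letter is read as the positive edge from the other end; reversing
      the segment changes the sign.\<close>
    have "bs_eq p (w @ [l, inv_letter l] @ []) (w @ [])" by (rule bs_cancel)
    then have e: "bs_elem p ((w @ [l]) @ [(s, True)]) = bs_elem p w"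
      using False by (simp add: bs_elem_eq_iff l inv_letter_def)
    then have We: "W ((w @ [l]) @ [(s, True)]) = W w" unfolding W_def by simp
    have Pe: "P ((w @ [l]) @ [(s, True)]) = P w"
      using arg_cong[OF e, of "coords p"] p0 by (simp add: P_def)
    from edge[of "w @ [l]" s] wl have
      "W w = W (w @ [l]) + winding_number (linepath (P (w @ [l])) (P w)) 0"
      "0 \<notin> path_image (linepath (P (w @ [l])) (P w))"
      unfolding e We Pe by auto
    then show ?thesis
      using winding_number_reversepath[of "linepath (P (w @ [l])) (P w)" 0] by simp
  qed
qed

lemma spoke_winding_replicate:
  assumes p: "p \<ge> 7" and comb: "is_1_combing p \<Psi>" and rad: "radial_tameness_function p \<Psi> (\<lambda>q. q + C)"
    and w: "real (length w) + real n + 1/4 + max C 0 < 3 * real h"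
    and "z \<noteq> 0" "\<And>i. i \<le> n \<Longrightarrow> vmap p (threes p h) (act p (0, 0) (w @ replicate i l)) = z"
  shows "spoke_winding p (threes p h) \<Psi> (bs_elem p (w @ replicate n l))
       = spoke_winding p (threes p h) \<Psi> (bs_elem p w)"
  using assms(4,6)
proof (induction n)
  case (Suc n)
  have "w @ replicate (Suc n) l = (w @ replicate n l) @ [l]" by (simp add: replicate_append_same)
  then have "spoke_winding p (threes p h) \<Psi> (bs_elem p (w @ replicate (Suc n) l))
     = spoke_winding p (threes p h) \<Psi> (bs_elem p (w @ replicate n l)) + winding_number (linepath z z) 0"
    using spoke_winding_snoc[OF p comb rad, of "w @ replicate n l" h l] Suc.prems(1)
      Suc.prems(2)[of n] Suc.prems(2)[of "Suc n"] by simp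
  with Suc \<open>z \<noteq> 0\<close> show ?case by simp
qed simp

text \<open>The counterclockwise rectangle has winding number 1. Its vertical sides are split at
  \<open>1\<close> and \<open>-1\<close>, the images of the ends on the base line, and the upper
  half is reversed.\<close>

lemma winding_number_square_loop:
  "winding_number (linepath (-1) (Complex (-1) 1)) 0 + winding_number (linepath (Complex (-1) 1) (Complex 1 1)) 0
     + winding_number (linepath (Complex 1 1) 1) 0 + 1
   = winding_number (linepath (-1) (Complex (-1) (-1))) 0
     + winding_number (linepath (Complex (-1) (-1)) (Complex 1 (-1))) 0
     + winding_number (linepath (Complex 1 (-1)) 1) 0"
proof -
  define a b c d where "a = Complex (-1) (-1)" "b = Complex 1 (-1)" "c = Complex 1 1" "d = Complex (-1) 1"
  note abcd = this
  have seg: "1 \<in> closed_segment b c" "-1 \<in> closed_segment d a"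
    by (auto simp: abcd closed_segment_same_Re closed_segment_eq_real_ivl)
  have nz: "0 \<notin> closed_segment a b" "0 \<notin> closed_segment b c" "0 \<notin> closed_segment c d" "0 \<notin> closed_segment d a"
    by (auto simp: abcd closed_segment_same_Re closed_segment_same_Im)
  have nz': "0 \<notin> closed_segment 1 c" "0 \<notin> closed_segment d (-1)" "0 \<notin> closed_segment (-1) a"
    by (auto simp: abcd closed_segment_same_Re)
  have rect: "rectpath a c = linepath a b +++ linepath b c +++ linepath c d +++ linepath d a"
    by (simp add: rectpath_def Let_def abcd)
  have "1 = winding_number (rectpath a c) 0"
    by (rule winding_number_rectpath[symmetric]) (simp add: abcd in_box_complex_iff)
  also have "\<dots> = winding_number (linepath a b) 0 + winding_number (linepath b c) 0
     + winding_number (linepath c d) 0 + winding_number (linepath d a) 0"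
    using nz by (simp add: rect winding_number_join path_image_join)
  finally have "winding_number (linepath a b) 0 + winding_number (linepath b c) 0
     + winding_number (linepath c d) 0 + winding_number (linepath d a) 0 = 1" by simp
  moreover have "winding_number (linepath b c) 0 = winding_number (linepath b 1) 0 + winding_number (linepath 1 c) 0"
    by (rule winding_number_split_linepath[OF seg(1) nz(2)])
  moreover have "winding_number (linepath d a) 0 = winding_number (linepath d (-1)) 0 + winding_number (linepath (-1) a) 0"
    by (rule winding_number_split_linepath[OF seg(2) nz(4)])
  moreover have "winding_number (linepath 1 c) 0 = - winding_number (linepath c 1) 0"
    using winding_number_reversepath[of "linepath 1 c" 0] nz' by simp
  moreover have "winding_number (linepath d (-1)) 0 = - winding_number (linepath (-1) d) 0"
    using winding_number_reversepath[of "linepath d (-1)" 0] nz' by simp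
  moreover have "winding_number (linepath c d) 0 = - winding_number (linepath d c) 0"
    using winding_number_reversepath[of "linepath c d" 0] nz by simp
  ultimately have "winding_number (linepath (-1) d) 0 + winding_number (linepath d c) 0
     + winding_number (linepath c 1) 0 + 1
   = winding_number (linepath (-1) a) 0 + winding_number (linepath a b) 0 + winding_number (linepath b 1) 0"
    by (simp add: algebra_simps)
  then show ?thesis unfolding abcd .
qed

section \<open>The loop formed by the two words\<close>

theorem theorem7p1:
  fixes p :: nat
  assumes "p \<ge> 8"
  shows "\<not> (\<exists>\<Psi> C. is_1_combing p \<Psi> \<and> radial_tameness_function p \<Psi> (\<lambda>q. q + C))"
proof
  assume "\<exists>\<Psi> C. is_1_combing p \<Psi> \<and> radial_tameness_function p \<Psi> (\<lambda>q. q + C)"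
  then obtain \<Psi> C where comb: "is_1_combing p \<Psi>" and rad: "radial_tameness_function p \<Psi> (\<lambda>q. q + C)"
    by blast
  have p: "p \<ge> 7" "p > 0" using assms by auto
  \<comment> \<open>Any \<open>h > 9/4 + max C 0\<close> gives
    \<open>2 * h + 2 + 1/4 + max C 0 < 3 * h\<close>. With \<open>h = m + 1\<close>,
    \<open>m\<close> of the letters in each power of \<open>t\<close> stay at one corner of the
    square and one joins it to the base line.\<close>
  obtain m :: nat where m: "real m > 3 + max C 0" using reals_Archimedean2 by blast
  define h where "h = Suc m"
  define c where "c = threes p h"
  let ?a = "(GA, True)" and ?t = "(GT, True)" and ?T = "(GT, False)"
  have h1: "int h \<ge> 1" and hm: "int h = int m + 1" by (simp_all add: h_def)
  define W where "W = (\<lambda>w. spoke_winding p c \<Psi> (bs_elem p w))"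
  define P where "P = (\<lambda>w. vmap p c (act p (0, 0) w))"
  have c: "3 \<le> c" "c < int p ^ h"
    using threes_bounds[OF p(1), of h] by (auto simp: c_def h_def)
  have c': "real_of_int c < real p ^ h"
    using c(2) by (metis of_int_less_iff of_int_of_nat_eq of_int_power)
  have step: "W (w @ [l]) = W w + winding_number (linepath (P w) (P (w @ [l]))) 0"
    if "length w \<le> 2 * h + 1" for w l
    unfolding W_def P_def c_def using that m
    by (intro spoke_winding_snoc[OF p(1) comb rad]) (auto simp: h_def)
  have rep: "W (w @ replicate n l) = W w"
    if "length w + n \<le> 2 * h + 2" "z \<noteq> 0" "\<And>i. i \<le> n \<Longrightarrow> P (w @ replicate i l) = z" for w n l z
    using that(1,3) m unfolding W_def P_def c_def
    by (intro spoke_winding_replicate[OF p(1) comb rad _ that(2)]) (auto simp: h_def)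
  have branch: "branch p 1" "branch p (1 + real p ^ h)" "\<not> branch p 0" "\<not> branch p (real p ^ h)"
  proof -
    show "branch p 1" unfolding branch_def by (intro exI[of _ 0]) simp
    show "branch p (1 + real p ^ h)" unfolding branch_def by (intro exI[of _ "int p ^ m"]) (simp add: h_def)
    have *: "\<not> branch p (real p * of_int n)" for n
    proof
      assume "branch p (real p * of_int n)"
      then obtain k where "real p * of_int n = 1 + real p * of_int k" by (auto simp: branch_def)
      then have "real_of_int (int p * (n - k)) = of_int 1" by (simp add: algebra_simps)
      then have "int p * (n - k) = 1" by (simp only: of_int_eq_iff)
      then have "int p dvd 1" by (metis dvd_triv_left)
      then show False using assms by simp
    qed
    from *[of 0] show "\<not> branch p 0" by simp
    from *[of "int p ^ m"] show "\<not> branch p (real p ^ h)" by (simp add: h_def)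
  qed
  \<comment> \<open>As \<open>1 < c < p^h\<close>, the points 0 and 1 are left of \<open>c\<close>
    and \<open>p^h\<close>, \<open>p^h + 1\<close> are right of it.\<close>
  have P: "vmap p c (0, 0) = -1" "vmap p c (0, 1) = -1"
    "vmap p c (0, real p ^ h) = 1" "vmap p c (0, 1 + real p ^ h) = 1" "vmap p c (0, real p ^ h + 1) = 1"
    "k \<ge> 1 \<Longrightarrow> vmap p c (k, 0) = Complex (-1) 1"
    "k \<ge> 1 \<Longrightarrow> vmap p c (k, 1) = Complex (-1) (-1)"
    "k \<ge> 1 \<Longrightarrow> vmap p c (k, real p ^ h) = Complex 1 1"
    "k \<ge> 1 \<Longrightarrow> vmap p c (k, 1 + real p ^ h) = Complex 1 (-1)" for k
    using c c' branch by (auto simp: vmap_def side_def complex_eq_iff sgn_if)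
  \<comment> \<open>This word stays off the branch and runs over the upper half of the
    square.\<close>
  have "W (replicate h ?t @ [?a] @ replicate h ?T @ [?a]) = W []
     + winding_number (linepath (-1) (Complex (-1) 1)) 0 + winding_number (linepath (Complex (-1) 1) (Complex 1 1)) 0
     + winding_number (linepath (Complex 1 1) 1) 0"
  proof -
    define w1 w2 where "w1 = replicate h ?t" "w2 = w1 @ [?a] @ replicate m ?T"
    have lw: "length w1 = h" by (simp add: w1_w2_def)
    have a1: "act p (0, 0) w1 = (int h, 0)" by (simp add: w1_w2_def act_replicate_GT)
    have a2: "act p (0, 0) (w1 @ [?a] @ replicate i ?T) = (int h - int i, real p ^ h)" for i
      by (simp add: a1 act_replicate_GT)
    have aw2: "act p (0, 0) w2 = (1, real p ^ h)"
      using a2[of m] by (simp add: w1_w2_def hm)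
    have lw2: "length w2 = 2 * h" by (simp add: w1_w2_def h_def)
    have "W w1 = W [?t]"
      using rep[of "[?t]" m "Complex (-1) 1" ?t] by (simp add: P_def P act_replicate_GT h_def w1_w2_def complex_eq_iff)
    also have "\<dots> = W [] + winding_number (linepath (-1) (Complex (-1) 1)) 0"
      using step[of "[]" ?t] by (simp add: P_def P)
    finally have 1: "W w1 = W [] + winding_number (linepath (-1) (Complex (-1) 1)) 0" .
    have 2: "W (w1 @ [?a]) = W w1 + winding_number (linepath (Complex (-1) 1) (Complex 1 1)) 0"
      using step[of w1 ?a] a1 h1 by (simp add: P_def P lw)
    have "P ((w1 @ [?a]) @ replicate i ?T) = Complex 1 1" if "i \<le> m" for i
      using a2[of i] that by (simp add: P_def P hm)
    then have "W ((w1 @ [?a]) @ replicate m ?T) = W (w1 @ [?a])"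
      by (intro rep[of _ _ "Complex 1 1"]) (auto simp: lw complex_eq_iff h_def)
    then have 3: "W w2 = W (w1 @ [?a])" by (simp add: w1_w2_def)
    have 4: "W (w2 @ [?T]) = W w2 + winding_number (linepath (Complex 1 1) 1) 0"
      using step[of w2 ?T] aw2 by (simp add: P_def P lw2)
    \<comment> \<open>The last letter joins \<open>p^h\<close> to \<open>p^h + 1\<close>, both
      mapped to \<open>1\<close>.\<close>
    have 5: "W ((w2 @ [?T]) @ [?a]) = W (w2 @ [?T])"
      using step[of "w2 @ [?T]" ?a] aw2 by (simp add: P_def P lw2)
    have e: "replicate h ?t @ [?a] @ replicate h ?T @ [?a] = (w2 @ [?T]) @ [?a]"
      by (simp add: w1_w2_def h_def replicate_append_same)
    show ?thesis unfolding e using 1 2 3 4 5 by simp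
  qed
  \<comment> \<open>The initial \<open>a\<close> leads to the root of the branch, so this word runs
    over the lower half.\<close>
  moreover have "W ([?a] @ replicate h ?t @ [?a] @ replicate h ?T) = W []
     + winding_number (linepath (-1) (Complex (-1) (-1))) 0
     + winding_number (linepath (Complex (-1) (-1)) (Complex 1 (-1))) 0
     + winding_number (linepath (Complex 1 (-1)) 1) 0"
  proof -
    define w1 w2 where "w1 = [?a] @ replicate h ?t" "w2 = w1 @ [?a] @ replicate m ?T"
    have lw: "length w1 = Suc h" by (simp add: w1_w2_def)
    have a1: "act p (0, 0) w1 = (int h, 1)" by (simp add: w1_w2_def act_replicate_GT)
    have a2: "act p (0, 0) (w1 @ [?a] @ replicate i ?T) = (int h - int i, 1 + real p ^ h)" for i
      by (simp add: a1 act_replicate_GT)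
    have aw2: "act p (0, 0) w2 = (1, 1 + real p ^ h)"
      using a2[of m] by (simp add: w1_w2_def hm)
    have lw2: "length w2 = 2 * h + 1" by (simp add: w1_w2_def h_def)
    have 0: "W [?a] = W []"
      using step[of "[]" ?a] by (simp add: P_def P)
    have "W w1 = W [?a, ?t]"
      using rep[of "[?a, ?t]" m "Complex (-1) (-1)" ?t]
      by (simp add: P_def P act_replicate_GT h_def w1_w2_def complex_eq_iff)
    also have "\<dots> = W [?a] + winding_number (linepath (-1) (Complex (-1) (-1))) 0"
      using step[of "[?a]" ?t] by (simp add: P_def P)
    finally have 1: "W w1 = W [] + winding_number (linepath (-1) (Complex (-1) (-1))) 0" using 0 by simp
    have 2: "W (w1 @ [?a]) = W w1 + winding_number (linepath (Complex (-1) (-1)) (Complex 1 (-1))) 0"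
      using step[of w1 ?a] a1 h1 by (simp add: P_def P lw)
    have "P ((w1 @ [?a]) @ replicate i ?T) = Complex 1 (-1)" if "i \<le> m" for i
      using a2[of i] that by (simp add: P_def P hm)
    then have "W ((w1 @ [?a]) @ replicate m ?T) = W (w1 @ [?a])"
      by (intro rep[of _ _ "Complex 1 (-1)"]) (auto simp: lw complex_eq_iff h_def)
    then have 3: "W w2 = W (w1 @ [?a])" by (simp add: w1_w2_def)
    have 4: "W (w2 @ [?T]) = W w2 + winding_number (linepath (Complex 1 (-1)) 1) 0"
      using step[of w2 ?T] aw2 by (simp add: P_def P lw2)
    have e: "[?a] @ replicate h ?t @ [?a] @ replicate h ?T = w2 @ [?T]"
      by (simp add: w1_w2_def h_def replicate_append_same)
    show ?thesis unfolding e using 1 2 3 4 by simp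
  qed
  moreover have "bs_elem p (replicate h ?t @ [?a] @ replicate h ?T @ [?a])
     = bs_elem p ([?a] @ replicate h ?t @ [?a] @ replicate h ?T)"
    using bs_eq_commute[of p h] by (simp add: bs_elem_eq_iff)
  then have "W (replicate h ?t @ [?a] @ replicate h ?T @ [?a]) = W ([?a] @ replicate h ?t @ [?a] @ replicate h ?T)"
    unfolding W_def by simp
  \<comment> \<open>Both words end at the same vertex, so \<open>W []\<close> cancels and the halves
    would have equal winding numbers.\<close>
  ultimately have "winding_number (linepath (-1) (Complex (-1) 1)) 0
     + winding_number (linepath (Complex (-1) 1) (Complex 1 1)) 0 + winding_number (linepath (Complex 1 1) 1) 0
   = winding_number (linepath (-1) (Complex (-1) (-1))) 0
     + winding_number (linepath (Complex (-1) (-1)) (Complex 1 (-1))) 0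
     + winding_number (linepath (Complex 1 (-1)) 1) 0"
    by (simp only: add.assoc add_left_cancel)
  with winding_number_square_loop show False by (metis add_cancel_left_right zero_neq_one)
qed

end
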